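(* Let $\mathcal{V}=\{v^1,\dots,v^{|\mathcal{V}|}\}$ be a finite vocabulary with $|\mathcal{V}|\ge 2$, let $\bm{a}_{i,t}=(a^1,\dots,a^{|\mathcal{V}|})\in\mathbb{R}^{|\mathcal{V}|}$ be the logit vector at decoding step $t$ of the sampled response $\bm{y}_i$ to a prompt $\bm{x}$, and let $\pi_\theta(v^n\mid \bm{x},\bm{y}_{i,<t})=e^{a^n}/\sum_{m=1}^{|\mathcal{V}|}e^{a^m}$ be the induced softmax distribution, with Shannon entropy $\mathcal{H}(\pi_\theta)=-\sum_{n=1}^{|\mathcal{V}|}\pi_\theta(v^n\mid \bm{x},\bm{y}_{i,<t})\ln\pi_\theta(v^n\mid \bm{x},\bm{y}_{i,<t})$. Let $y_{i,t}\in\mathcal{V}$ be the target token, let $\hat{A}_i\in\mathbb{R}$ be the advantage, let $\pi_{\theta_{\mathrm{old}}}(y_{i,t}\mid \bm{x},\bm{y}_{i,<t})>0$ be the fixed behavior-policy probability of $y_{i,t}$, and let $\rho_{i,t}=\pi_\theta(y_{i,t}\mid \bm{x},\bm{y}_{i,<t})/\pi_{\theta_{\mathrm{old}}}(y_{i,t}\mid \bm{x},\bm{y}_{i,<t})$. Let $\mathcal{J}$ be the per-token clipped objective with clipping parameters $\epsilon_{\mathrm{low}}\in(0,1)$ and $\epsilon_{\mathrm{high}}>0$, $$\mathcal{J}=\min\bigl(\rho_{i,t}\hat{A}_i,\ \mathrm{clip}(\rho_{i,t},1-\epsilon_{\mathrm{low}},1+\epsilon_{\mathrm{high}})\hat{A}_i\bigr),$$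 viewed as a function of $\bm{a}_{i,t}$. Then the squared $\ell_2$-norm of the gradient of $\mathcal{J}$ with respect to the logits satisfies $$|w_{i,t}|^2\Bigl(1-2\pi_\theta(y_{i,t}\mid \bm{x},\bm{y}_{i,<t})+e^{-\mathcal{H}(\pi_\theta)}\Bigr)\ \le\ \|\nabla_{\bm{a}_{i,t}}\mathcal{J}\|^2\ \le\ |w_{i,t}|^2\Bigl(2-2\pi_\theta(y_{i,t}\mid \bm{x},\bm{y}_{i,<t})-C_V\,\mathcal{H}(\pi_\theta)^2\Bigr),$$ where $C_V=\dfrac{|\mathcal{V}|-1}{|\mathcal{V}|(\ln|\mathcal{V}|)^2}$ and $$w_{i,t}=\begin{cases}0, & \text{if } (\hat{A}_i>0 \text{ and } \rho_{i,t}>1+\epsilon_{\mathrm{high}})\ \text{or}\ (\hat{A}_i<0\text{ and }\rho_{i,t}<1-\epsilon_{\mathrm{low}}),\\[4pt] \dfrac{\pi_\theta(y_{i,t}\mid \bm{x},\bm{y}_{i,<t})}{\pi_{\theta_{\mathrm{old}}}(y_{i,t}\mid \bm{x},\bm{y}_{i,<t})}\,\hat{A}_i, & \text{otherwise.}\end{cases}$$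
   Context: A language model is a policy $\pi_\theta$ generating a response $\bm{y}_i=(y_{i,1},y_{i,2},\dots)$ token by token, where $\bm{y}_{i,<t}$ denotes the tokens preceding position $t$; at step $t$ the next token has the softmax distribution of the logits $\bm{a}_{i,t}$. The quantities $\hat{A}_i$ (a real number) and $\pi_{\theta_{\mathrm{old}}}(y_{i,t}\mid\bm{x},\bm{y}_{i,<t})$ (a positive number) are constants that do not depend on $\bm{a}_{i,t}$. Here $\mathrm{clip}(r,l,u)=\min(\max(r,l),u)$. All logarithms are natural. Gradient convention: at the clipping thresholds where $\mathcal{J}$ may fail to be differentiable ($\hat{A}_i>0$ and $\rho_{i,t}=1+\epsilon_{\mathrm{high}}$, or $\hat{A}_i<0$ and $\rho_{i,t}=1-\epsilon_{\mathrm{low}}$), $\nabla_{\bm{a}_{i,t}}\mathcal{J}$ denotes the gradient of the unclipped branch $\rho_{i,t}\hat{A}_i$, consistently with the definition of $w_{i,t}$. *)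

theory Defs
  imports "HOL-Analysis.Analysis"
begin

text \<open>The vocabulary is the finite type \<open>'v\<close>, and a logit vector is an element of \<open>real ^ 'v\<close>.
  The prompt and the prefix are fixed throughout, so the policy at the given decoding step is
  determined by the logits.\<close>

definition softmax :: "real ^ 'v \<Rightarrow> 'v::finite \<Rightarrow> real" where
  "softmax a v = exp (a $ v) / (\<Sum>m\<in>UNIV. exp (a $ m))"

definition shannon_entropy :: "('v::finite \<Rightarrow> real) \<Rightarrow> real" where
  "shannon_entropy p = - (\<Sum>v\<in>UNIV. p v * ln (p v))"

definition clip :: "real \<Rightarrow> real \<Rightarrow> real \<Rightarrow> real" where
  "clip r l u = min (max r l) u"

text \<open>In the following, \<open>y\<close> is the target token, \<open>p_old\<close> its probability under the behaviour
  policy, and \<open>A\<close> the advantage.\<close>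

definition ratio :: "'v::finite \<Rightarrow> real \<Rightarrow> real ^ 'v \<Rightarrow> real" where
  "ratio y p_old a = softmax a y / p_old"

definition objective :: "real \<Rightarrow> real \<Rightarrow> real \<Rightarrow> real \<Rightarrow> 'v::finite \<Rightarrow> real ^ 'v \<Rightarrow> real" where
  "objective eps_low eps_high A p_old y a =
     min (ratio y p_old a * A)
         (clip (ratio y p_old a) (1 - eps_low) (1 + eps_high) * A)"

definition at_threshold :: "real \<Rightarrow> real \<Rightarrow> real \<Rightarrow> real \<Rightarrow> 'v::finite \<Rightarrow> real ^ 'v \<Rightarrow> bool" where
  "at_threshold eps_low eps_high A p_old y a \<longleftrightarrow>
     (A > 0 \<and> ratio y p_old a = 1 + eps_high) \<or> (A < 0 \<and> ratio y p_old a = 1 - eps_low)"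

text \<open>The gradient of the objective with respect to the logits. At a clipping threshold, where the
  objective may fail to be differentiable, it is by convention the gradient of the unclipped
  branch; everywhere else it is the ordinary gradient.\<close>

definition has_objective_gradient ::
  "real \<Rightarrow> real \<Rightarrow> real \<Rightarrow> real \<Rightarrow> 'v::finite \<Rightarrow> real ^ 'v \<Rightarrow> real ^ 'v \<Rightarrow> bool" where
  "has_objective_gradient eps_low eps_high A p_old y a g \<longleftrightarrow>
     (if at_threshold eps_low eps_high A p_old y a
      then GDERIV (\<lambda>b. ratio y p_old b * A) a :> g
      else GDERIV (objective eps_low eps_high A p_old y) a :> g)"

definition objective_gradient ::
  "real \<Rightarrow> real \<Rightarrow> real \<Rightarrow> real \<Rightarrow> 'v::finite \<Rightarrow> real ^ 'v \<Rightarrow> real ^ 'v" where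
  "objective_gradient eps_low eps_high A p_old y a =
     (THE g. has_objective_gradient eps_low eps_high A p_old y a g)"

definition weight :: "real \<Rightarrow> real \<Rightarrow> real \<Rightarrow> real \<Rightarrow> 'v::finite \<Rightarrow> real ^ 'v \<Rightarrow> real" where
  "weight eps_low eps_high A p_old y a =
     (if (A > 0 \<and> ratio y p_old a > 1 + eps_high) \<or> (A < 0 \<and> ratio y p_old a < 1 - eps_low)
      then 0
      else softmax a y / p_old * A)"

definition C_V :: "nat \<Rightarrow> real" where
  "C_V n = (real n - 1) / (real n * (ln (real n))\<^sup>2)"

end

theory Submission
  imports Defs
begin

text \<open>Off the clipped region the gradient is \<open>w (e\<^sub>y - p)\<close> with \<open>p\<close> the softmax
  distribution, so its squared norm is \<open>w\<^sup>2 (1 - 2 p\<^sub>y + \<Sum> p\<^sub>v\<^sup>2)\<close>; on the clipped region it is zero.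
  Both bounds thus reduce to bounds on the collision probability \<open>\<Sum> p\<^sub>v\<^sup>2\<close>.
  Jensen's inequality for \<open>exp\<close> gives \<open>exp (- H) \<le> \<Sum> p\<^sub>v\<^sup>2\<close>. For the other bound,
  write \<open>H = \<Sum> \<surd>(p (1 - p)) \<cdot> \<surd>(p / (1 - p)) (- ln p)\<close>; Cauchy--Schwarz gives
  \<open>H\<^sup>2 \<le> (1 - \<Sum> p\<^sup>2) \<cdot> \<Sum> p (ln p)\<^sup>2 / (1 - p)\<close>, and as \<open>p (ln p)\<^sup>2 / (1 - p)\<close> is concave on
  the unit interval, Jensen's inequality bounds the last sum by its value
  \<open>n (ln n)\<^sup>2 / (n - 1) = 1 / C_V n\<close> at the uniform distribution.\<close>

section \<open>Concavity of the odds-weighted squared logarithm\<close>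

lemma ln_sq_quadratic_nonpos:
  fixes x :: real
  assumes "0 < x" "x \<le> 1"
  shows "x * (ln x)\<^sup>2 + (1 - x\<^sup>2) * ln x + (1 - x)\<^sup>2 \<le> 0"
proof -
  \<comment> \<open>Dividing the claimed expression by \<open>x\<close> makes the derivative
    collapse to one term of known sign; moreover \<open>k 1 = 0\<close>.\<close>
  define k where "k x = (ln x)\<^sup>2 + ln x * (1 / x - x) + 1 / x - 2 + x" for x :: real
  have "k x \<le> k 1"
  proof (rule DERIV_nonneg_imp_nondecreasing[OF assms(2)])
    fix t :: real assume t: "x \<le> t" "t \<le> 1"
    with assms have "t > 0" by linarith
    have "(k has_real_derivative - (ln t * ((1 - t) / t)\<^sup>2)) (at t)"
      unfolding k_def using \<open>t > 0\<close>
      by (auto intro!: derivative_eq_intros simp: field_simps power2_eq_square)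
    moreover have "ln t * ((1 - t) / t)\<^sup>2 \<le> 0"
      using \<open>t > 0\<close> t by (intro mult_nonpos_nonneg) auto
    ultimately show "\<exists>d. (k has_real_derivative d) (at t) \<and> d \<ge> 0"
      by (intro exI[of _ "- (ln t * ((1 - t) / t)\<^sup>2)"]) auto
  qed
  then have "x * k x \<le> 0"
    using assms by (intro mult_nonneg_nonpos) (simp_all add: k_def)
  also have "x * k x = x * (ln x)\<^sup>2 + (1 - x\<^sup>2) * ln x + (1 - x)\<^sup>2"
    using assms by (simp add: k_def field_simps power2_eq_square)
  finally show ?thesis .
qed

text \<open>The second derivative has a positive denominator on the open interval, and its numerator
  is twice the expression of \<open>ln_sq_quadratic_nonpos\<close>.\<close>

lemma concave_on_odds_ln_sq:
  "concave_on {0<..<1} (\<lambda>x::real. x / (1 - x) * (ln x)\<^sup>2)"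
proof (rule f''_le0_imp_concave)
  show "convex {0<..<1::real}" by simp
  fix x :: real assume "x \<in> {0<..<1}"
  then have x: "0 < x" "x < 1" by auto
  show "((\<lambda>x. x / (1 - x) * (ln x)\<^sup>2) has_real_derivative
      (ln x / (1 - x))\<^sup>2 + 2 * ln x / (1 - x)) (at x)"
    using x by (auto intro!: derivative_eq_intros simp: divide_simps) (simp add: power2_eq_square algebra_simps)
  show "((\<lambda>x. (ln x / (1 - x))\<^sup>2 + 2 * ln x / (1 - x)) has_real_derivative
      2 * (x * (ln x)\<^sup>2 + (1 - x\<^sup>2) * ln x + (1 - x)\<^sup>2) / (x * (1 - x) ^ 3)) (at x)"
    by (rule derivative_eq_intros refl | (use x in simp; fail))+
      (use x in \<open>simp add: divide_simps; simp add: power2_eq_square power3_eq_cube algebra_simps\<close>)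
  show "2 * (x * (ln x)\<^sup>2 + (1 - x\<^sup>2) * ln x + (1 - x)\<^sup>2) / (x * (1 - x) ^ 3) \<le> 0"
    using ln_sq_quadratic_nonpos[of x] x by (intro divide_nonpos_pos) auto
qed

section \<open>Entropy bounds on the collision probability\<close>

lemma exp_neg_entropy_le_collision:
  fixes p :: "'v::finite \<Rightarrow> real"
  assumes pos: "\<And>v. p v > 0" and sum: "(\<Sum>v\<in>UNIV. p v) = 1"
  shows "exp (- shannon_entropy p) \<le> (\<Sum>v\<in>UNIV. (p v)\<^sup>2)"
proof -
  have "exp (- shannon_entropy p) = exp (\<Sum>v\<in>UNIV. p v *\<^sub>R ln (p v))"
    by (simp add: shannon_entropy_def)
  \<comment> \<open>Jensen with weights \<open>p v\<close> at the points
    \<open>ln (p v)\<close>.\<close>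
  also have "\<dots> \<le> (\<Sum>v\<in>UNIV. p v * exp (ln (p v)))"
    using pos by (intro convex_on_sum[OF _ _ exp_convex sum]) (auto intro: less_imp_le)
  also have "\<dots> = (\<Sum>v\<in>UNIV. (p v)\<^sup>2)"
    using pos by (simp add: power2_eq_square)
  finally show ?thesis .
qed

lemma collision_le_entropy_sq:
  fixes p :: "'v::finite \<Rightarrow> real"
  assumes pos: "\<And>v. p v > 0" and lt1: "\<And>v. p v < 1" and sum: "(\<Sum>v\<in>UNIV. p v) = 1"
    and card: "CARD('v) \<ge> 2"
  shows "(\<Sum>v\<in>UNIV. (p v)\<^sup>2) \<le> 1 - C_V CARD('v) * (shannon_entropy p)\<^sup>2"
proof -
  define n where "n = real CARD('v)"
  define g where "g x = x / (1 - x) * (ln x)\<^sup>2" for x :: real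
  have n: "n \<ge> 2" using card by (simp add: n_def)
  \<comment> \<open>Here the Jensen weights are all \<open>1 / n\<close>; since the
    \<open>p v\<close> sum to 1, their mean is \<open>1 / n\<close>.\<close>
  have "(\<Sum>v\<in>UNIV. (1 / n) * g (p v)) \<le> g (\<Sum>v\<in>UNIV. (1 / n) *\<^sub>R p v)"
    using n pos lt1 unfolding g_def
    by (intro concave_on_sum[OF _ _ concave_on_odds_ln_sq]) (auto simp: n_def)
  also have "(\<Sum>v\<in>UNIV. (1 / n) *\<^sub>R p v) = 1 / n"
    using sum by (simp flip: sum_divide_distrib)
  also have "g (1 / n) = (ln n)\<^sup>2 / (n - 1)"
    using n by (simp add: g_def ln_div divide_simps)
  finally have jensen: "(\<Sum>v\<in>UNIV. g (p v)) \<le> n * (ln n)\<^sup>2 / (n - 1)"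
    using n by (simp add: field_simps flip: sum_divide_distrib)
  have "(shannon_entropy p)\<^sup>2 =
      (\<Sum>v\<in>UNIV. sqrt (p v * (1 - p v)) * (sqrt (p v / (1 - p v)) * ln (p v)))\<^sup>2"
  proof -
    have "sqrt (p v * (1 - p v)) * (sqrt (p v / (1 - p v)) * ln (p v)) = p v * ln (p v)" for v
    proof -
      have "sqrt (p v * (1 - p v)) * sqrt (p v / (1 - p v)) = sqrt ((p v)\<^sup>2)"
        using lt1[of v] by (simp add: power2_eq_square flip: real_sqrt_mult)
      also have "\<dots> = p v" using pos[of v] by simp
      finally show ?thesis by (simp flip: mult.assoc)
    qed
    then show ?thesis by (simp only: shannon_entropy_def power2_minus)
  qed
  also have "\<dots> \<le> (\<Sum>v\<in>UNIV. (sqrt (p v * (1 - p v)))\<^sup>2)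
      * (\<Sum>v\<in>UNIV. (sqrt (p v / (1 - p v)) * ln (p v))\<^sup>2)"
    by (rule Cauchy_Schwarz_ineq_sum)
  also have "(\<Sum>v\<in>UNIV. (sqrt (p v * (1 - p v)))\<^sup>2) = 1 - (\<Sum>v\<in>UNIV. (p v)\<^sup>2)"
    using pos lt1 sum
    by (simp add: less_imp_le algebra_simps sum_subtractf power2_eq_square)
  also have "(\<Sum>v\<in>UNIV. (sqrt (p v / (1 - p v)) * ln (p v))\<^sup>2) = (\<Sum>v\<in>UNIV. g (p v))"
    using pos lt1 by (simp add: g_def power_mult_distrib less_imp_le)
  also have "(1 - (\<Sum>v\<in>UNIV. (p v)\<^sup>2)) * (\<Sum>v\<in>UNIV. g (p v))
      \<le> (1 - (\<Sum>v\<in>UNIV. (p v)\<^sup>2)) * (n * (ln n)\<^sup>2 / (n - 1))"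
  proof (rule mult_left_mono[OF jensen])
    have "(\<Sum>v\<in>UNIV. (p v)\<^sup>2) \<le> (\<Sum>v\<in>UNIV. p v)"
      using pos lt1 by (intro sum_mono) (simp add: power2_eq_square less_imp_le)
    then show "0 \<le> 1 - (\<Sum>v\<in>UNIV. (p v)\<^sup>2)" using sum by simp
  qed
  \<comment> \<open>As \<open>n \<ge> 2\<close>, both \<open>n - 1\<close> and \<open>ln n\<close>
    are positive, so the Jensen bound can be moved across; its reciprocal is
    \<open>C_V\<close>.\<close>
  finally have "(shannon_entropy p)\<^sup>2 * ((n - 1) / (n * (ln n)\<^sup>2)) \<le> 1 - (\<Sum>v\<in>UNIV. (p v)\<^sup>2)"
    using n by (simp add: field_simps)
  then show ?thesis by (simp add: C_V_def n_def mult.commute)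
qed

section \<open>The softmax distribution and its gradient\<close>

lemma softmax_pos: "softmax a v > 0"
  unfolding softmax_def by (intro divide_pos_pos sum_pos) auto

lemma sum_softmax: "(\<Sum>v\<in>UNIV. softmax a v) = 1"
proof -
  have "(\<Sum>m\<in>UNIV. exp (a $ m)) > 0" by (intro sum_pos) auto
  then show ?thesis by (simp add: softmax_def flip: sum_divide_distrib)
qed

text \<open>A second token takes positive mass. This keeps the denominators \<open>1 - p v\<close>
  in the Cauchy-Schwarz step away from zero.\<close>

lemma softmax_less_1:
  fixes a :: "real ^ 'v::finite"
  assumes "CARD('v) \<ge> 2"
  shows "softmax a v < 1"
proof -
  have "UNIV - {v} \<noteq> {}"
    using assms card_mono[of "{v}" UNIV] by auto
  then have "(\<Sum>u\<in>UNIV - {v}. softmax a u) > 0"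
    by (intro sum_pos softmax_pos) auto
  then show ?thesis
    using sum_softmax[of a] by (simp add: sum.remove[of UNIV v])
qed

lemma GDERIV_softmax:
  "GDERIV (\<lambda>b. softmax b y) a :> softmax a y *\<^sub>R (axis y 1 - (\<chi> m. softmax a m))"
proof -
  define S where "S = (\<Sum>m\<in>UNIV. exp (a $ m))"
  have S: "S > 0" unfolding S_def by (intro sum_pos) auto
  have nth: "((\<lambda>b. b $ m) has_derivative (\<lambda>h. h $ m)) (at a)" for m
    by (rule bounded_linear_imp_has_derivative[OF bounded_linear_vec_nth])
  have "((\<lambda>b. exp (b $ y) / (\<Sum>m\<in>UNIV. exp (b $ m))) has_derivative
      (\<lambda>h. (exp (a $ y) * h $ y * S - exp (a $ y) * (\<Sum>m\<in>UNIV. exp (a $ m) * h $ m)) / (S * S))) (at a)"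
    unfolding S_def
    by (rule derivative_eq_intros nth refl)+ (use S in \<open>auto simp: S_def mult_ac\<close>)
  \<comment> \<open>The quotient-rule differential, rewritten as an inner product with
    \<open>h\<close>, exhibits the gradient: the row of the softmax Jacobian at
    \<open>y\<close>.\<close>
  moreover have "(exp (a $ y) * h $ y * S - exp (a $ y) * (\<Sum>m\<in>UNIV. exp (a $ m) * h $ m)) / (S * S)
      = h \<bullet> (softmax a y *\<^sub>R (axis y 1 - (\<chi> m. softmax a m)))" for h
  proof -
    have "h \<bullet> (\<chi> m. softmax a m) = (\<Sum>m\<in>UNIV. exp (a $ m) * h $ m) / S"
      by (simp add: inner_vec_def softmax_def S_def sum_divide_distrib mult.commute)
    then have "h \<bullet> (softmax a y *\<^sub>R (axis y 1 - (\<chi> m. softmax a m)))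
        = exp (a $ y) / S * (h $ y - (\<Sum>m\<in>UNIV. exp (a $ m) * h $ m) / S)"
      by (simp add: inner_diff_right inner_axis softmax_def S_def)
    then show ?thesis using S by (simp add: field_simps)
  qed
  ultimately show ?thesis
    by (simp add: gderiv_def softmax_def[abs_def])
qed

lemma norm_axis_minus_sq:
  fixes p :: "'v::finite \<Rightarrow> real"
  shows "(norm (axis y 1 - (\<chi> m. p m)))\<^sup>2 = 1 - 2 * p y + (\<Sum>v\<in>UNIV. (p v)\<^sup>2)"
proof -
  have "(\<chi> m. p m) \<bullet> (\<chi> m. p m) = (\<Sum>v\<in>UNIV. (p v)\<^sup>2)"
    by (simp add: inner_vec_def power2_eq_square)
  then show ?thesis
    by (simp add: power2_norm_eq_inner inner_diff_left inner_diff_right inner_axis inner_axis' inner_axis_axis)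
qed

section \<open>The gradient of the clipped objective\<close>

lemma GDERIV_transform_open:
  assumes "GDERIV f x :> d" "open S" "x \<in> S" "\<And>z. z \<in> S \<Longrightarrow> f z = g z"
  shows "GDERIV g x :> d"
  using assms unfolding gderiv_def by (rule has_derivative_transform_within_open)

lemma GDERIV_unique:
  assumes "GDERIV f x :> d" "GDERIV f x :> e"
  shows "d = e"
  using has_derivative_unique[OF assms[unfolded gderiv_def]]
  by (metis inner_commute vector_eq_rdot)

lemma GDERIV_ratio:
  "GDERIV (\<lambda>b. ratio y p_old b * A) a :>
     (softmax a y / p_old * A) *\<^sub>R (axis y 1 - (\<chi> m. softmax a m))"
  unfolding ratio_def
  using GDERIV_DERIV_compose[OF GDERIV_softmax
      DERIV_cmult_right[OF DERIV_cdivide[OF DERIV_ident, of p_old], of A]]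
  by (simp add: mult.commute)

text \<open>The outer \<open>min\<close> undoes clipping from below, so only the upper threshold
  survives.\<close>

lemma objective_pos:
  assumes "A > 0" "eps_low > 0" "eps_high > 0"
  shows "objective eps_low eps_high A p_old y b = min (ratio y p_old b) (1 + eps_high) * A"
  using assms by (auto simp: objective_def clip_def min_def max_def)

text \<open>The negative factor turns the outer \<open>min\<close> into a \<open>max\<close> of
  ratios, which undoes clipping from above.\<close>

lemma objective_neg:
  assumes "A < 0" "eps_low > 0" "eps_high > 0"
  shows "objective eps_low eps_high A p_old y b = max (ratio y p_old b) (1 - eps_low) * A"
  using assms by (auto simp: objective_def clip_def min_def max_def)

text \<open>Away from the thresholds, continuity of the ratio makes the strict inequalities hold on
  an open neighbourhood, where the objective is either constant or equal to the unclipped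
  branch.\<close>

lemma has_objective_gradient_weight:
  assumes "eps_low > 0" "eps_high > 0"
  shows "has_objective_gradient eps_low eps_high A p_old y a
    (weight eps_low eps_high A p_old y a *\<^sub>R (axis y 1 - (\<chi> m. softmax a m)))"
proof -
  let ?r = "ratio y p_old" and ?g = "axis y 1 - (\<chi> m. softmax a m)"
  let ?J = "objective eps_low eps_high A p_old y"
  let ?w = "weight eps_low eps_high A p_old y a"
  have unclipped: "GDERIV (\<lambda>b. ?r b * A) a :> (softmax a y / p_old * A) *\<^sub>R ?g"
    by (rule GDERIV_ratio)
  have cont: "continuous_on UNIV ?r"
    unfolding ratio_def softmax_def divide_inverse
    by (intro continuous_intros ballI less_imp_neq[THEN not_sym] sum_pos) auto
  have op: "open {b. ?r b < c}" "open {b. ?r b > c}" for c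
    by (auto intro!: open_Collect_less continuous_intros cont)
  consider "at_threshold eps_low eps_high A p_old y a"
    | "A = 0" | "A > 0" "?r a > 1 + eps_high" | "A > 0" "?r a < 1 + eps_high"
    | "A < 0" "?r a < 1 - eps_low" | "A < 0" "?r a > 1 - eps_low"
    unfolding at_threshold_def by linarith
  then show ?thesis
  proof cases
    case 1
    \<comment> \<open>The inequalities in \<open>weight\<close> are strict, so equality falls under
      its unclipped case, matching the gradient convention.\<close>
    then have "?w = softmax a y / p_old * A"
      by (auto simp: weight_def at_threshold_def)
    with 1 unclipped show ?thesis by (simp add: has_objective_gradient_def)
  next
    case 2
    then show ?thesis
      by (simp add: has_objective_gradient_def at_threshold_def weight_def objective_def[abs_def] GDERIV_const)
  next
    case 3
    have "GDERIV ?J a :> 0"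
      by (rule GDERIV_transform_open[OF GDERIV_const[of "(1 + eps_high) * A"] op(2)[of "1 + eps_high"]])
        (use 3 assms in \<open>auto simp: objective_pos\<close>)
    with 3 show ?thesis
      by (simp add: has_objective_gradient_def at_threshold_def weight_def)
  next
    case 4
    have "GDERIV ?J a :> (softmax a y / p_old * A) *\<^sub>R ?g"
      by (rule GDERIV_transform_open[OF unclipped op(1)[of "1 + eps_high"]])
        (use 4 assms in \<open>auto simp: objective_pos\<close>)
    with 4 show ?thesis
      by (simp add: has_objective_gradient_def at_threshold_def weight_def)
  next
    case 5
    have "GDERIV ?J a :> 0"
      by (rule GDERIV_transform_open[OF GDERIV_const[of "(1 - eps_low) * A"] op(1)[of "1 - eps_low"]])
        (use 5 assms in \<open>auto simp: objective_neg\<close>)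
    with 5 show ?thesis
      by (simp add: has_objective_gradient_def at_threshold_def weight_def)
  next
    case 6
    have "GDERIV ?J a :> (softmax a y / p_old * A) *\<^sub>R ?g"
      by (rule GDERIV_transform_open[OF unclipped op(2)[of "1 - eps_low"]])
        (use 6 assms in \<open>auto simp: objective_neg\<close>)
    with 6 show ?thesis
      by (simp add: has_objective_gradient_def at_threshold_def weight_def)
  qed
qed

lemma objective_gradient_eqI:
  assumes "has_objective_gradient eps_low eps_high A p_old y a g"
  shows "objective_gradient eps_low eps_high A p_old y a = g"
  unfolding objective_gradient_def
proof (rule the_equality, rule assms)
  show "h = g" if "has_objective_gradient eps_low eps_high A p_old y a h" for h
    using that assms by (auto simp: has_objective_gradient_def split: if_splits intro: GDERIV_unique)
qed

theorem theorem3p3: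
  fixes a :: "real ^ 'v::finite" and y :: 'v and A p_old eps_low eps_high :: real
  assumes "CARD('v) \<ge> 2"
    and "p_old > 0"
    and "0 < eps_low" "eps_low < 1"
    and "eps_high > 0"
  shows "has_objective_gradient eps_low eps_high A p_old y a
           (objective_gradient eps_low eps_high A p_old y a)
       \<and> \<bar>weight eps_low eps_high A p_old y a\<bar>\<^sup>2
           * (1 - 2 * softmax a y + exp (- shannon_entropy (softmax a)))
         \<le> (norm (objective_gradient eps_low eps_high A p_old y a))\<^sup>2
       \<and> (norm (objective_gradient eps_low eps_high A p_old y a))\<^sup>2
         \<le> \<bar>weight eps_low eps_high A p_old y a\<bar>\<^sup>2
           * (2 - 2 * softmax a y - C_V CARD('v) * (shannon_entropy (softmax a))\<^sup>2)"
proof -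
  let ?g = "objective_gradient eps_low eps_high A p_old y a"
  let ?w = "weight eps_low eps_high A p_old y a"
  let ?p = "softmax a"
  have grad: "has_objective_gradient eps_low eps_high A p_old y a (?w *\<^sub>R (axis y 1 - (\<chi> m. ?p m)))"
    using assms by (intro has_objective_gradient_weight)
  \<comment> \<open>The formula covers the clipped region too, where \<open>?w = 0\<close>, so no
    case split is needed for the bounds.\<close>
  then have g: "?g = ?w *\<^sub>R (axis y 1 - (\<chi> m. ?p m))"
    by (rule objective_gradient_eqI)
  then have norm: "(norm ?g)\<^sup>2 = \<bar>?w\<bar>\<^sup>2 * (1 - 2 * ?p y + (\<Sum>v\<in>UNIV. (?p v)\<^sup>2))"
    by (simp add: power_mult_distrib norm_axis_minus_sq)
  have "exp (- shannon_entropy ?p) \<le> (\<Sum>v\<in>UNIV. (?p v)\<^sup>2)"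
    by (intro exp_neg_entropy_le_collision softmax_pos sum_softmax)
  moreover have "(\<Sum>v\<in>UNIV. (?p v)\<^sup>2) \<le> 1 - C_V CARD('v) * (shannon_entropy ?p)\<^sup>2"
    using assms(1) by (intro collision_le_entropy_sq softmax_pos softmax_less_1 sum_softmax)
  \<comment> \<open>Both bounds are multiplied by the nonnegative
    \<open>\<bar>?w\<bar>\<^sup>2\<close>; the first conjunct is \<open>grad\<close> rewritten with
    \<open>g\<close>.\<close>
  ultimately show ?thesis
    using grad unfolding norm by (auto simp: g intro!: mult_left_mono)
qed

end
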